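(* For any locally small category $\mathcal{C}$, the collection of all universal colim sieves on $\mathcal{C}$ is the canonical topology on $\mathcal{C}$.
   Context: A sieve $S$ on an object $X$ of $\mathcal{C}$ is a collection of morphisms with codomain $X$ closed under precomposition; it is viewed as a full subcategory of $(\mathcal{C}\downarrow X)$, and $U\colon S\to\mathcal{C}$ is the forgetful functor $U(f)=\operatorname{domain} f$. For $\alpha\colon Y\to X$, $\alpha^*S=\{g \mid \operatorname{codomain} g=Y,\ \alpha\circ g\in S\}$. A sieve $S$ on $X$ is a colim sieve if $\operatorname{colim}_S U$ exists and the canonical map $\operatorname{colim}_S U\to X$ is an isomorphism. $S$ is a universal colim sieve if $\alpha^*S$ is a colim sieve on $Y$ for every morphism $\alpha\colon Y\to X$ in $\mathcal{C}$. The canonical topology on $\mathcal{C}$ is the largest Grothendieck topology on $\mathcal{C}$ (defined via covering sieves) for which all representable presheaves $\mathcal{C}(-,M)$ are sheaves. *)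

theory Defs
  imports Main
begin

section \<open>Categories\<close>

text \<open>
  The morphisms between two objects form a set over the type of morphisms, so every category
  in this sense is locally small; no size restriction is placed on the collection of objects.
\<close>

record ('o, 'm) cat =
  Obj  :: "'o set"
  Mor  :: "'m set"
  Dom  :: "'m \<Rightarrow> 'o"
  Cod  :: "'m \<Rightarrow> 'o"
  Ident :: "'o \<Rightarrow> 'm"
  Comp :: "'m \<Rightarrow> 'm \<Rightarrow> 'm"  (infixl "\<cdot>\<index>" 70)

definition hom :: "('o, 'm) cat \<Rightarrow> 'o \<Rightarrow> 'o \<Rightarrow> 'm set" where
  "hom C X Y = {f \<in> Mor C. Dom C f = X \<and> Cod C f = Y}"

locale category =
  fixes C :: "('o, 'm) cat" (structure)
  assumes dom_obj: "f \<in> Mor C \<Longrightarrow> Dom C f \<in> Obj C"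
    and cod_obj: "f \<in> Mor C \<Longrightarrow> Cod C f \<in> Obj C"
    and ident_hom: "X \<in> Obj C \<Longrightarrow> Ident C X \<in> hom C X X"
    and comp_hom: "\<lbrakk>g \<in> hom C Y Z; f \<in> hom C X Y\<rbrakk> \<Longrightarrow> g \<cdot> f \<in> hom C X Z"
    and comp_ident_right: "f \<in> hom C X Y \<Longrightarrow> f \<cdot> Ident C X = f"
    and comp_ident_left: "f \<in> hom C X Y \<Longrightarrow> Ident C Y \<cdot> f = f"
    and comp_assoc: "\<lbrakk>h \<in> hom C Y Z; g \<in> hom C X Y; f \<in> hom C W X\<rbrakk>
        \<Longrightarrow> (h \<cdot> g) \<cdot> f = h \<cdot> (g \<cdot> f)"

definition isomorphism :: "('o, 'm) cat \<Rightarrow> 'm \<Rightarrow> bool" where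
  "isomorphism C f \<longleftrightarrow> f \<in> Mor C \<and>
     (\<exists>g \<in> hom C (Cod C f) (Dom C f).
        g \<cdot>\<^bsub>C\<^esub> f = Ident C (Dom C f) \<and> f \<cdot>\<^bsub>C\<^esub> g = Ident C (Cod C f))"

definition full_subcategory :: "('o, 'm) cat \<Rightarrow> 'o set \<Rightarrow> ('o, 'm) cat" where
  "full_subcategory C S =
     C\<lparr>Obj := S, Mor := {f \<in> Mor C. Dom C f \<in> S \<and> Cod C f \<in> S}\<rparr>"

text \<open>
  A morphism of the slice category from \<open>f\<close> to \<open>g\<close> is encoded as the triple \<open>(f, h, g)\<close>,
  where \<open>f = g \<cdot> h\<close>.
\<close>

definition slice :: "('o, 'm) cat \<Rightarrow> 'o \<Rightarrow> ('m, 'm \<times> 'm \<times> 'm) cat" where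
  "slice C X = \<lparr>
     Obj = {f \<in> Mor C. Cod C f = X},
     Mor = {(f, h, g). f \<in> Mor C \<and> g \<in> Mor C \<and> Cod C f = X \<and> Cod C g = X \<and>
              h \<in> hom C (Dom C f) (Dom C g) \<and> g \<cdot>\<^bsub>C\<^esub> h = f},
     Dom = (\<lambda>(f, h, g). f),
     Cod = (\<lambda>(f, h, g). g),
     Ident = (\<lambda>f. (f, Ident C (Dom C f), f)),
     Comp = (\<lambda>(f', h', g') (f, h, g). (f, h' \<cdot>\<^bsub>C\<^esub> h, g'))\<rparr>"


section \<open>Functors and colimits\<close>

locale cat_functor = A: category A + B: category B
  for A :: "('a, 'b) cat" and B :: "('o, 'm) cat" +
  fixes Fo :: "'a \<Rightarrow> 'o" and Fm :: "'b \<Rightarrow> 'm"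
  assumes obj_map: "X \<in> Obj A \<Longrightarrow> Fo X \<in> Obj B"
    and mor_map: "f \<in> hom A X Y \<Longrightarrow> Fm f \<in> hom B (Fo X) (Fo Y)"
    and ident_map: "X \<in> Obj A \<Longrightarrow> Fm (Ident A X) = Ident B (Fo X)"
    and comp_map: "\<lbrakk>g \<in> hom A Y Z; f \<in> hom A X Y\<rbrakk>
        \<Longrightarrow> Fm (g \<cdot>\<^bsub>A\<^esub> f) = Fm g \<cdot>\<^bsub>B\<^esub> Fm f"

definition cocone ::
  "('a, 'b) cat \<Rightarrow> ('o, 'm) cat \<Rightarrow> ('a \<Rightarrow> 'o) \<Rightarrow> ('b \<Rightarrow> 'm) \<Rightarrow> 'o \<Rightarrow> ('a \<Rightarrow> 'm) \<Rightarrow> bool"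
where
  "cocone J C Fo Fm L \<mu> \<longleftrightarrow> L \<in> Obj C \<and> (\<forall>j \<in> Obj J. \<mu> j \<in> hom C (Fo j) L) \<and>
     (\<forall>u \<in> Mor J. \<mu> (Cod J u) \<cdot>\<^bsub>C\<^esub> Fm u = \<mu> (Dom J u))"

definition cocone_map ::
  "('a, 'b) cat \<Rightarrow> ('o, 'm) cat \<Rightarrow> 'o \<Rightarrow> ('a \<Rightarrow> 'm) \<Rightarrow> 'o \<Rightarrow> ('a \<Rightarrow> 'm) \<Rightarrow> 'm \<Rightarrow> bool"
where
  "cocone_map J C L \<mu> M \<nu> h \<longleftrightarrow> h \<in> hom C L M \<and> (\<forall>j \<in> Obj J. h \<cdot>\<^bsub>C\<^esub> \<mu> j = \<nu> j)"

definition colimit ::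
  "('a, 'b) cat \<Rightarrow> ('o, 'm) cat \<Rightarrow> ('a \<Rightarrow> 'o) \<Rightarrow> ('b \<Rightarrow> 'm) \<Rightarrow> 'o \<Rightarrow> ('a \<Rightarrow> 'm) \<Rightarrow> bool"
where
  "colimit J C Fo Fm L \<mu> \<longleftrightarrow> cocone J C Fo Fm L \<mu> \<and>
     (\<forall>M \<nu>. cocone J C Fo Fm M \<nu> \<longrightarrow> (\<exists>!h. cocone_map J C L \<mu> M \<nu> h))"


section \<open>Sieves\<close>

definition sieve :: "('o, 'm) cat \<Rightarrow> 'o \<Rightarrow> 'm set \<Rightarrow> bool" where
  "sieve C X S \<longleftrightarrow> X \<in> Obj C \<and> S \<subseteq> {f \<in> Mor C. Cod C f = X} \<and>
     (\<forall>f \<in> S. \<forall>g \<in> Mor C. Cod C g = Dom C f \<longrightarrow> f \<cdot>\<^bsub>C\<^esub> g \<in> S)"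

definition maximal_sieve :: "('o, 'm) cat \<Rightarrow> 'o \<Rightarrow> 'm set" where
  "maximal_sieve C X = {f \<in> Mor C. Cod C f = X}"

definition pullback_sieve :: "('o, 'm) cat \<Rightarrow> 'm \<Rightarrow> 'm set \<Rightarrow> 'm set" where
  "pullback_sieve C \<alpha> S = {g \<in> Mor C. Cod C g = Dom C \<alpha> \<and> \<alpha> \<cdot>\<^bsub>C\<^esub> g \<in> S}"

abbreviation sieve_category :: "('o, 'm) cat \<Rightarrow> 'o \<Rightarrow> 'm set \<Rightarrow> ('m, 'm \<times> 'm \<times> 'm) cat" where
  "sieve_category C X S \<equiv> full_subcategory (slice C X) S"

text \<open>The two components of the forgetful functor \<open>U\<close> from a sieve to the category.\<close>

abbreviation (input) forget_obj :: "('o, 'm) cat \<Rightarrow> 'm \<Rightarrow> 'o" where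
  "forget_obj C \<equiv> Dom C"

abbreviation (input) forget_mor :: "'m \<times> 'm \<times> 'm \<Rightarrow> 'm" where
  "forget_mor \<equiv> \<lambda>(f, h, g). h"

text \<open>
  The members of a sieve on \<open>X\<close> are themselves the legs of a cocone from \<open>U\<close> to \<open>X\<close>; the
  canonical map from the colimit to \<open>X\<close> is the map induced by this cocone.
\<close>

definition colim_sieve :: "('o, 'm) cat \<Rightarrow> 'o \<Rightarrow> 'm set \<Rightarrow> bool" where
  "colim_sieve C X S \<longleftrightarrow> sieve C X S \<and>
     (\<exists>L \<mu>. colimit (sieve_category C X S) C (forget_obj C) forget_mor L \<mu> \<and>
        (\<exists>h. cocone_map (sieve_category C X S) C L \<mu> X (\<lambda>f. f) h \<and> isomorphism C h))"

definition universal_colim_sieve :: "('o, 'm) cat \<Rightarrow> 'o \<Rightarrow> 'm set \<Rightarrow> bool" where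
  "universal_colim_sieve C X S \<longleftrightarrow> sieve C X S \<and>
     (\<forall>\<alpha> \<in> Mor C. Cod C \<alpha> = X \<longrightarrow> colim_sieve C (Dom C \<alpha>) (pullback_sieve C \<alpha> S))"

text \<open>
  Collections of sieves are sets of pairs \<open>(X, S)\<close> with \<open>S\<close> a sieve on \<open>X\<close>; the object has to be
  recorded because the empty set is a sieve on every object.
\<close>

definition universal_colim_sieves :: "('o, 'm) cat \<Rightarrow> ('o \<times> 'm set) set" where
  "universal_colim_sieves C = {(X, S). universal_colim_sieve C X S}"


section \<open>Grothendieck topologies and sheaves\<close>

definition grothendieck_topology :: "('o, 'm) cat \<Rightarrow> ('o \<times> 'm set) set \<Rightarrow> bool" where
  "grothendieck_topology C J \<longleftrightarrow>
     (\<forall>(X, S) \<in> J. sieve C X S) \<and>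
     (\<forall>X \<in> Obj C. (X, maximal_sieve C X) \<in> J) \<and>
     (\<forall>(X, S) \<in> J. \<forall>\<alpha> \<in> Mor C. Cod C \<alpha> = X \<longrightarrow> (Dom C \<alpha>, pullback_sieve C \<alpha> S) \<in> J) \<and>
     (\<forall>(X, S) \<in> J. \<forall>R. sieve C X R \<longrightarrow>
        (\<forall>f \<in> S. (Dom C f, pullback_sieve C f R) \<in> J) \<longrightarrow> (X, R) \<in> J)"

text \<open>
  A presheaf of sets is given by its sets of sections \<open>P X\<close> and, for each morphism \<open>f\<close>, the
  restriction map \<open>r f\<close> from \<open>P (Cod C f)\<close> to \<open>P (Dom C f)\<close>.
\<close>

locale presheaf = category C
  for C :: "('o, 'm) cat" (structure) +
  fixes P :: "'o \<Rightarrow> 'e set" and r :: "'m \<Rightarrow> 'e \<Rightarrow> 'e"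
  assumes restrict_in: "\<lbrakk>f \<in> hom C X Y; x \<in> P Y\<rbrakk> \<Longrightarrow> r f x \<in> P X"
    and restrict_ident: "\<lbrakk>X \<in> Obj C; x \<in> P X\<rbrakk> \<Longrightarrow> r (Ident C X) x = x"
    and restrict_comp: "\<lbrakk>g \<in> hom C Y Z; f \<in> hom C X Y; x \<in> P Z\<rbrakk>
        \<Longrightarrow> r (g \<cdot> f) x = r f (r g x)"

definition matching_family ::
  "('o, 'm) cat \<Rightarrow> ('o \<Rightarrow> 'e set) \<Rightarrow> ('m \<Rightarrow> 'e \<Rightarrow> 'e) \<Rightarrow> 'm set \<Rightarrow> ('m \<Rightarrow> 'e) \<Rightarrow> bool"
where
  "matching_family C P r S x \<longleftrightarrow> (\<forall>f \<in> S. x f \<in> P (Dom C f)) \<and>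
     (\<forall>f \<in> S. \<forall>g \<in> Mor C. Cod C g = Dom C f \<longrightarrow> x (f \<cdot>\<^bsub>C\<^esub> g) = r g (x f))"

definition sheaf ::
  "('o, 'm) cat \<Rightarrow> ('o \<times> 'm set) set \<Rightarrow> ('o \<Rightarrow> 'e set) \<Rightarrow> ('m \<Rightarrow> 'e \<Rightarrow> 'e) \<Rightarrow> bool"
where
  "sheaf C J P r \<longleftrightarrow> presheaf C P r \<and>
     (\<forall>(X, S) \<in> J. \<forall>x. matching_family C P r S x \<longrightarrow>
        (\<exists>!t. t \<in> P X \<and> (\<forall>f \<in> S. r f t = x f)))"

definition representable_sections :: "('o, 'm) cat \<Rightarrow> 'o \<Rightarrow> 'o \<Rightarrow> 'm set" where
  "representable_sections C M = (\<lambda>X. hom C X M)"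

definition representable_restrict :: "('o, 'm) cat \<Rightarrow> 'm \<Rightarrow> 'm \<Rightarrow> 'm" where
  "representable_restrict C f = (\<lambda>h. h \<cdot>\<^bsub>C\<^esub> f)"

definition representables_are_sheaves :: "('o, 'm) cat \<Rightarrow> ('o \<times> 'm set) set \<Rightarrow> bool" where
  "representables_are_sheaves C J \<longleftrightarrow>
     (\<forall>M \<in> Obj C. sheaf C J (representable_sections C M) (representable_restrict C))"

text \<open>\<open>J\<close> is the largest topology with the property, not merely a maximal one.\<close>

definition canonical_topology :: "('o, 'm) cat \<Rightarrow> ('o \<times> 'm set) set \<Rightarrow> bool" where
  "canonical_topology C J \<longleftrightarrow>
     grothendieck_topology C J \<and> representables_are_sheaves C J \<and>
     (\<forall>K. grothendieck_topology C K \<longrightarrow> representables_are_sheaves C K \<longrightarrow> K \<subseteq> J)"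

lemma canonical_topology_unique:
  "canonical_topology C J \<Longrightarrow> canonical_topology C K \<Longrightarrow> J = K"
  unfolding canonical_topology_def by blast


section \<open>Well-definedness of the constructions\<close>

lemma hom_slice:
  "u \<in> hom (slice C X) f g \<longleftrightarrow> f \<in> Mor C \<and> g \<in> Mor C \<and> Cod C f = X \<and> Cod C g = X \<and>
     (\<exists>h \<in> hom C (Dom C f) (Dom C g). g \<cdot>\<^bsub>C\<^esub> h = f \<and> u = (f, h, g))"
  by (cases u) (auto simp: hom_def slice_def)

lemma slice_simps:
  "Obj (slice C X) = {f \<in> Mor C. Cod C f = X}"
  "Ident (slice C X) f = (f, Ident C (Dom C f), f)"
  "(f', h', g') \<cdot>\<^bsub>slice C X\<^esub> (f, h, g) = (f, h' \<cdot>\<^bsub>C\<^esub> h, g')"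
  by (simp_all add: slice_def)

lemma (in category) slice_category: "category (slice C X)"
proof (rule category.intro)
  fix u assume "u \<in> Mor (slice C X)"
  then show "Dom (slice C X) u \<in> Obj (slice C X)" "Cod (slice C X) u \<in> Obj (slice C X)"
    by (auto simp: slice_def)
next
  fix f assume "f \<in> Obj (slice C X)"
  then have f: "f \<in> Mor C" "Cod C f = X" by (simp_all add: slice_simps)
  then have "f \<in> hom C (Dom C f) X" by (simp add: hom_def)
  then have "f \<cdot> Ident C (Dom C f) = f" by (rule comp_ident_right)
  with f show "Ident (slice C X) f \<in> hom (slice C X) f f"
    using ident_hom[OF dom_obj[OF f(1)]] by (simp add: hom_slice slice_simps)
next
  fix v u f g k assume "v \<in> hom (slice C X) g k" "u \<in> hom (slice C X) f g"
  then obtain h h' where u: "u = (f, h, g)" "h \<in> hom C (Dom C f) (Dom C g)" "g \<cdot> h = f"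
    and v: "v = (g, h', k)" "h' \<in> hom C (Dom C g) (Dom C k)" "k \<cdot> h' = g"
    and X: "f \<in> Mor C" "Cod C f = X" "k \<in> Mor C" "Cod C k = X"
    unfolding hom_slice by blast
  have "k \<in> hom C (Dom C k) X" using X by (simp add: hom_def)
  from comp_assoc[OF this v(2) u(2)] have "k \<cdot> (h' \<cdot> h) = f" by (simp only: u(3) v(3))
  with X comp_hom[OF v(2) u(2)] show "v \<cdot>\<^bsub>slice C X\<^esub> u \<in> hom (slice C X) f k"
    unfolding hom_slice u(1) v(1) slice_simps by blast
next
  fix u f g assume "u \<in> hom (slice C X) f g"
  then obtain h where h: "u = (f, h, g)" "h \<in> hom C (Dom C f) (Dom C g)"
    unfolding hom_slice by blast
  show "u \<cdot>\<^bsub>slice C X\<^esub> Ident (slice C X) f = u"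
    by (simp only: h(1) slice_simps comp_ident_right[OF h(2)])
  show "Ident (slice C X) g \<cdot>\<^bsub>slice C X\<^esub> u = u"
    by (simp only: h(1) slice_simps comp_ident_left[OF h(2)])
next
  fix w v u e f g k
  assume "w \<in> hom (slice C X) g k" "v \<in> hom (slice C X) f g" "u \<in> hom (slice C X) e f"
  then obtain h h' h'' where u: "u = (e, h, f)" "h \<in> hom C (Dom C e) (Dom C f)"
    and v: "v = (f, h', g)" "h' \<in> hom C (Dom C f) (Dom C g)"
    and w: "w = (g, h'', k)" "h'' \<in> hom C (Dom C g) (Dom C k)"
    unfolding hom_slice by blast
  show "(w \<cdot>\<^bsub>slice C X\<^esub> v) \<cdot>\<^bsub>slice C X\<^esub> u = w \<cdot>\<^bsub>slice C X\<^esub> (v \<cdot>\<^bsub>slice C X\<^esub> u)"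
    by (simp only: u(1) v(1) w(1) slice_simps comp_assoc[OF w(2) v(2) u(2)])
qed

lemma hom_full_subcategory:
  "f \<in> hom (full_subcategory C S) X Y \<longleftrightarrow> f \<in> hom C X Y \<and> X \<in> S \<and> Y \<in> S"
  by (auto simp: full_subcategory_def hom_def)

lemma full_subcategory_simps:
  "Obj (full_subcategory C S) = S"
  "Ident (full_subcategory C S) = Ident C"
  "Comp (full_subcategory C S) = Comp C"
  by (simp_all add: full_subcategory_def)

lemma full_subcategory_category:
  assumes "category C" "S \<subseteq> Obj C"
  shows "category (full_subcategory C S)"
proof (rule category.intro, unfold hom_full_subcategory full_subcategory_simps)
  interpret category C by fact
  show "Dom (full_subcategory C S) f \<in> S" "Cod (full_subcategory C S) f \<in> S"
    if "f \<in> Mor (full_subcategory C S)" for f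
    using that by (simp_all add: full_subcategory_def)
  show "Ident C X \<in> hom C X X \<and> X \<in> S \<and> X \<in> S" if "X \<in> S" for X
    using that assms(2) ident_hom by blast
qed (use category.comp_hom[OF assms(1)] category.comp_ident_right[OF assms(1)]
    category.comp_ident_left[OF assms(1)] category.comp_assoc[OF assms(1)] in blast)+

lemma (in category) sieve_category_category:
  "sieve C X S \<Longrightarrow> category (sieve_category C X S)"
  by (rule full_subcategory_category[OF slice_category]) (auto simp: sieve_def slice_def)

lemma (in category) forget_functor:
  assumes "sieve C X S"
  shows "cat_functor (sieve_category C X S) C (forget_obj C) forget_mor"
proof -
  interpret A: category "sieve_category C X S" using assms by (rule sieve_category_category)
  show ?thesis
    using assms by unfold_locales
      (auto simp: sieve_def slice_def full_subcategory_def hom_def dom_obj)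
qed

lemma (in category) sieve_cocone:
  "sieve C X S \<Longrightarrow> cocone (sieve_category C X S) C (forget_obj C) forget_mor X (\<lambda>f. f)"
  by (auto simp: sieve_def cocone_def slice_def full_subcategory_def hom_def)

lemma (in category) pullback_is_sieve:
  assumes "sieve C X S" "\<alpha> \<in> hom C Y X"
  shows "sieve C Y (pullback_sieve C \<alpha> S)"
proof -
  have "\<alpha> \<cdot> (f \<cdot> g) \<in> S \<and> f \<cdot> g \<in> Mor C \<and> Cod C (f \<cdot> g) = Y"
    if "f \<in> Mor C" "Cod C f = Y" "\<alpha> \<cdot> f \<in> S" "g \<in> Mor C" "Cod C g = Dom C f" for f g
  proof -
    have f: "f \<in> hom C (Dom C f) Y" and g: "g \<in> hom C (Dom C g) (Dom C f)"
      using that by (auto simp: hom_def)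
    have "Dom C (\<alpha> \<cdot> f) = Dom C f" using comp_hom[OF assms(2) f] by (simp add: hom_def)
    then have "(\<alpha> \<cdot> f) \<cdot> g \<in> S" using assms(1) that by (simp add: sieve_def)
    then show ?thesis using comp_assoc[OF assms(2) f g] comp_hom[OF f g] by (simp add: hom_def)
  qed
  then show ?thesis
    using assms(2) dom_obj by (auto simp: sieve_def pullback_sieve_def hom_def)
qed

lemma (in category) representable_presheaf:
  "presheaf C (representable_sections C M) (representable_restrict C)"
proof unfold_locales
  show "representable_restrict C f x \<in> representable_sections C M X"
    if "f \<in> hom C X Y" "x \<in> representable_sections C M Y" for f X Y x
    using that comp_hom unfolding representable_sections_def representable_restrict_def by blast
  show "representable_restrict C (Ident C X) x = x"
    if "x \<in> representable_sections C M X" for X x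
    using that comp_ident_right
    unfolding representable_sections_def representable_restrict_def by blast
  show "representable_restrict C (g \<cdot> f) x =
      representable_restrict C f (representable_restrict C g x)"
    if "g \<in> hom C Y Z" "f \<in> hom C X Y" "x \<in> representable_sections C M Z" for f g x X Y Z
    using that comp_assoc[of x Z M g Y f X]
    unfolding representable_sections_def representable_restrict_def by simp
qed

end

theory Submission imports Defs begin

text \<open>
  A cocone from the forgetful functor of a sieve \<open>S\<close> on \<open>X\<close> to an object \<open>M\<close> is the same thing as
  a matching family on \<open>S\<close> for the presheaf represented by \<open>M\<close>. Hence \<open>S\<close> is a colim sieve iff
  all representables satisfy the sheaf condition at \<open>S\<close>, and a topology for which they are sheaves
  consists of universal colim sieves because it is stable under pullback. The remaining point is
  transitivity: if \<open>S\<close> is universal and the pullbacks of \<open>R\<close> along \<open>S\<close> are, then a matching family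
  on \<open>R\<close> is glued on each \<open>f\<^sup>*R\<close> with \<open>f \<in> S\<close>, and the results are glued on \<open>S\<close>. That the final
  map restricts correctly along \<open>f \<in> R\<close> is tested on \<open>f\<^sup>*S\<close>, where universality of \<open>S\<close> is used.
\<close>

text \<open>These are the effective-epimorphic sieves: the sheaf condition at one sieve, for all
  representables at once. This form avoids colimits, and the closure properties of the topology are
  proved in it.\<close>

definition effective_sieve :: "('o, 'm) cat \<Rightarrow> 'o \<Rightarrow> 'm set \<Rightarrow> bool" where
  "effective_sieve C X S \<longleftrightarrow> sieve C X S \<and>
     (\<forall>M \<in> Obj C. \<forall>x.
        matching_family C (representable_sections C M) (representable_restrict C) S x \<longrightarrow>
        (\<exists>!t. t \<in> hom C X M \<and> (\<forall>f \<in> S. t \<cdot>\<^bsub>C\<^esub> f = x f)))"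

section \<open>Matching families in representables: existence and uniqueness of gluings\<close>

lemma matching_family_representable:
  "matching_family C (representable_sections C M) (representable_restrict C) S x \<longleftrightarrow>
     (\<forall>f \<in> S. x f \<in> hom C (Dom C f) M) \<and>
     (\<forall>f \<in> S. \<forall>g \<in> Mor C. Cod C g = Dom C f \<longrightarrow> x (f \<cdot>\<^bsub>C\<^esub> g) = x f \<cdot>\<^bsub>C\<^esub> g)"
  by (simp add: matching_family_def representable_sections_def representable_restrict_def)

lemma sieve_hom: "sieve C X S \<Longrightarrow> f \<in> S \<Longrightarrow> f \<in> hom C (Dom C f) X"
  by (auto simp: sieve_def hom_def)

lemma sieve_comp: "sieve C X S \<Longrightarrow> f \<in> S \<Longrightarrow> g \<in> hom C Y (Dom C f) \<Longrightarrow> f \<cdot>\<^bsub>C\<^esub> g \<in> S"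
  by (auto simp: sieve_def hom_def)

lemma homD:
  assumes "f \<in> hom C X Y"
  shows "f \<in> Mor C" "Dom C f = X" "Cod C f = Y"
  using assms by (auto simp: hom_def)

lemma pullback_sieve_iff:
  "\<alpha> \<in> hom C Y X \<Longrightarrow> g \<in> pullback_sieve C \<alpha> S \<longleftrightarrow> g \<in> hom C (Dom C g) Y \<and> \<alpha> \<cdot>\<^bsub>C\<^esub> g \<in> S"
  by (auto simp: pullback_sieve_def hom_def)

lemma effective_sieve_glue:
  assumes "effective_sieve C X S" "M \<in> Obj C"
    and "\<And>f. f \<in> S \<Longrightarrow> x f \<in> hom C (Dom C f) M"
    and "\<And>f g. f \<in> S \<Longrightarrow> g \<in> hom C (Dom C g) (Dom C f) \<Longrightarrow> x (f \<cdot>\<^bsub>C\<^esub> g) = x f \<cdot>\<^bsub>C\<^esub> g"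
  obtains t where "t \<in> hom C X M" "\<And>f. f \<in> S \<Longrightarrow> t \<cdot>\<^bsub>C\<^esub> f = x f"
proof -
  have "matching_family C (representable_sections C M) (representable_restrict C) S x"
    unfolding matching_family_representable using assms(3,4) by (simp add: hom_def)
  then have "\<exists>!t. t \<in> hom C X M \<and> (\<forall>f \<in> S. t \<cdot>\<^bsub>C\<^esub> f = x f)"
    using assms(1,2) unfolding effective_sieve_def by blast
  then show ?thesis using that by blast
qed

context category
begin

text \<open>Both \<open>t\<close> and \<open>u\<close> glue the family
  \<open>\<lambda>f. t \<cdot> f\<close>, which matches by associativity. This is the uniqueness
  half of effectiveness, as \<open>effective_sieve_glue\<close> is the existence half.\<close>

lemma effective_sieve_ext:
  assumes S: "effective_sieve C X S" and t: "t \<in> hom C X M" "u \<in> hom C X M"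
    and eq: "\<And>f. f \<in> S \<Longrightarrow> t \<cdot> f = u \<cdot> f"
  shows "t = u"
proof -
  have sv: "sieve C X S" using S by (simp add: effective_sieve_def)
  have M: "M \<in> Obj C" using t(1) cod_obj by (auto simp: hom_def)
  have "matching_family C (representable_sections C M) (representable_restrict C) S (\<lambda>f. t \<cdot> f)"
    unfolding matching_family_representable
  proof (intro conjI ballI impI)
    fix f assume f: "f \<in> S"
    note fh = sieve_hom[OF sv f]
    show "t \<cdot> f \<in> hom C (Dom C f) M" by (rule comp_hom[OF t(1) fh])
    fix g assume "g \<in> Mor C" "Cod C g = Dom C f"
    then have "g \<in> hom C (Dom C g) (Dom C f)" by (simp add: hom_def)
    from comp_assoc[OF t(1) fh this] show "t \<cdot> (f \<cdot> g) = t \<cdot> f \<cdot> g" by simp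
  qed
  then have "\<exists>!v. v \<in> hom C X M \<and> (\<forall>f \<in> S. v \<cdot> f = t \<cdot> f)"
    using S M unfolding effective_sieve_def by blast
  then show ?thesis using t eq by metis
qed

section \<open>Colim sieves as effective-epimorphic sieves\<close>

lemma cocone_iff_matching_family:
  assumes sv: "sieve C X S"
  shows "cocone (sieve_category C X S) C (forget_obj C) forget_mor M x \<longleftrightarrow> M \<in> Obj C \<and>
     matching_family C (representable_sections C M) (representable_restrict C) S x"
    (is "?cocone \<longleftrightarrow> _ \<and> ?matching")
proof -
  let ?J = "sieve_category C X S"
  \<comment> \<open>Morphisms of the sieve category are triangles with both legs in
    \<open>S\<close>, so naturality of a cocone is a condition on pairs of members.\<close>
  have "?cocone \<longleftrightarrow> M \<in> Obj C \<and> (\<forall>f \<in> S. x f \<in> hom C (Dom C f) M) \<and>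
      (\<forall>f \<in> S. \<forall>g \<in> S. \<forall>h \<in> hom C (Dom C f) (Dom C g). g \<cdot> h = f \<longrightarrow> x g \<cdot> h = x f)"
  proof -
    have "Obj ?J = S" "Cod ?J (f, h, g) = g" "Dom ?J (f, h, g) = f" for f h g
      by (simp_all add: slice_def full_subcategory_def)
    moreover have "(f, h, g) \<in> Mor ?J \<longleftrightarrow>
        f \<in> S \<and> g \<in> S \<and> h \<in> hom C (Dom C f) (Dom C g) \<and> g \<cdot> h = f" for f h g
      using sv by (auto simp: slice_def full_subcategory_def sieve_def)
    ultimately show ?thesis unfolding cocone_def split_paired_all split_paired_All
      by (simp add: Ball_def) blast
  qed
  also have "\<dots> \<longleftrightarrow> M \<in> Obj C \<and> ?matching"
  proof -
    \<comment> \<open>Matching lets \<open>h\<close> be any morphism into the domain of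
      \<open>g\<close>. Closure under precomposition makes \<open>g \<cdot> h\<close> a member, so
      each such \<open>h\<close> already gives a triangle in the sieve category.\<close>
    have "g \<cdot> h \<in> S \<and> h \<in> hom C (Dom C (g \<cdot> h)) (Dom C g)"
      if "g \<in> S" "h \<in> Mor C" "Cod C h = Dom C g" for g h
    proof -
      have h: "h \<in> hom C (Dom C h) (Dom C g)" using that by (simp add: hom_def)
      show ?thesis
        using sieve_comp[OF sv that(1) h] homD(2)[OF comp_hom[OF sieve_hom[OF sv that(1)] h]] h
        by simp
    qed
    note closed = this
    have "(\<forall>f \<in> S. \<forall>g \<in> S. \<forall>h \<in> hom C (Dom C f) (Dom C g). g \<cdot> h = f \<longrightarrow> x g \<cdot> h = x f) \<longleftrightarrow>
        (\<forall>g \<in> S. \<forall>h \<in> Mor C. Cod C h = Dom C g \<longrightarrow> x (g \<cdot> h) = x g \<cdot> h)"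
      (is "?L \<longleftrightarrow> ?R")
    proof
      assume ?L then show ?R using closed by metis
    next
      assume ?R then show ?L using homD(1,3) by metis
    qed
    then show ?thesis unfolding matching_family_representable by simp
  qed
  finally show ?thesis .
qed

text \<open>Composing with the invertible canonical map \<open>h\<close> and its inverse identifies
  maps out of \<open>L\<close> with maps out of \<open>X\<close>, so the universal property passes
  to \<open>X\<close>. Conversely, an effective sieve has \<open>X\<close> itself as colimit, with
  its members as legs and the identity as canonical map.\<close>

lemma colim_sieve_iff_effective: "colim_sieve C X S \<longleftrightarrow> effective_sieve C X S"
proof
  let ?J = "sieve_category C X S"
  have Obj_J: "Obj ?J = S" by (simp add: full_subcategory_def)
  {
    assume "colim_sieve C X S"
    then obtain L \<mu> h where sv: "sieve C X S"
      and col: "colimit ?J C (forget_obj C) forget_mor L \<mu>"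
      and hm: "cocone_map ?J C L \<mu> X (\<lambda>f. f) h" and iso: "isomorphism C h"
      unfolding colim_sieve_def by blast
    have h: "h \<in> hom C L X" and h\<mu>: "\<And>f. f \<in> S \<Longrightarrow> h \<cdot> \<mu> f = f"
      using hm Obj_J by (auto simp: cocone_map_def)
    have \<mu>: "\<And>f. f \<in> S \<Longrightarrow> \<mu> f \<in> hom C (Dom C f) L"
      using col Obj_J by (auto simp: colimit_def cocone_def)
    obtain k where k: "k \<in> hom C X L" "k \<cdot> h = Ident C L" "h \<cdot> k = Ident C X"
      using iso h by (auto simp: isomorphism_def hom_def)
    show "effective_sieve C X S" unfolding effective_sieve_def
    proof (intro conjI ballI allI impI sv)
      fix M x
      assume M: "M \<in> Obj C"
        "matching_family C (representable_sections C M) (representable_restrict C) S x"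
      then have "cocone ?J C (forget_obj C) forget_mor M x"
        using cocone_iff_matching_family[OF sv] by simp
      then have ex1: "\<exists>!e. e \<in> hom C L M \<and> (\<forall>f\<in>S. e \<cdot> \<mu> f = x f)"
        using col Obj_J unfolding colimit_def cocone_map_def by simp
      then obtain e where e: "e \<in> hom C L M" "\<And>f. f \<in> S \<Longrightarrow> e \<cdot> \<mu> f = x f" by blast
      show "\<exists>!t. t \<in> hom C X M \<and> (\<forall>f\<in>S. t \<cdot> f = x f)"
      proof (intro ex1I[of _ "e \<cdot> k"] conjI ballI)
        show "e \<cdot> k \<in> hom C X M" by (rule comp_hom[OF e(1) k(1)])
        fix f assume f: "f \<in> S"
        have "k \<cdot> f = k \<cdot> (h \<cdot> \<mu> f)" using h\<mu>[OF f] by simp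
        also have "\<dots> = \<mu> f"
          using comp_assoc[OF k(1) h \<mu>[OF f]] k(2) comp_ident_left[OF \<mu>[OF f]] by simp
        finally show "e \<cdot> k \<cdot> f = x f"
          using comp_assoc[OF e(1) k(1) sieve_hom[OF sv f]] e(2)[OF f] by simp
      next
        fix t assume t: "t \<in> hom C X M \<and> (\<forall>f\<in>S. t \<cdot> f = x f)"
        \<comment> \<open>A competing gluing becomes, after composition with \<open>h\<close>, a
          mediating map out of the colimit; it therefore equals \<open>e\<close>, and
          \<open>h\<close> is cancelled on the right by \<open>k\<close>.\<close>
        then have "t \<cdot> h \<in> hom C L M" "\<forall>f\<in>S. (t \<cdot> h) \<cdot> \<mu> f = x f"
          using comp_hom[OF _ h] comp_assoc[OF _ h \<mu>] h\<mu> by auto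
        with ex1 e have "t \<cdot> h = e" by blast
        then show "t = e \<cdot> k"
          using t comp_assoc[OF _ h k(1)] k(3) comp_ident_right by metis
      qed
    qed
  next
    assume eff: "effective_sieve C X S"
    then have sv: "sieve C X S" and X: "X \<in> Obj C" by (simp_all add: effective_sieve_def sieve_def)
    have id: "Ident C X \<in> hom C X X" using ident_hom[OF X] .
    have "colimit ?J C (forget_obj C) forget_mor X (\<lambda>f. f)"
      unfolding colimit_def cocone_map_def Obj_J cocone_iff_matching_family[OF sv]
      using eff sieve_cocone[OF sv] cocone_iff_matching_family[OF sv]
      by (auto simp: effective_sieve_def)
    moreover have "cocone_map ?J C X (\<lambda>f. f) X (\<lambda>f. f) (Ident C X)"
      using id comp_ident_left[OF sieve_hom[OF sv]] Obj_J by (auto simp: cocone_map_def)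
    moreover have "isomorphism C (Ident C X)"
      using id comp_ident_left[OF id] by (auto simp: isomorphism_def hom_def)
    ultimately show "colim_sieve C X S" unfolding colim_sieve_def using sv by blast
  }
qed

lemma universal_colim_sieve_iff:
  "universal_colim_sieve C X S \<longleftrightarrow> sieve C X S \<and>
     (\<forall>Y. \<forall>\<alpha> \<in> hom C Y X. effective_sieve C Y (pullback_sieve C \<alpha> S))"
  unfolding universal_colim_sieve_def colim_sieve_iff_effective by (auto simp: hom_def)

section \<open>Pullbacks and universality\<close>

lemma pullback_sieve_comp:
  assumes "\<alpha> \<in> hom C Y X" "\<beta> \<in> hom C Z Y"
  shows "pullback_sieve C \<beta> (pullback_sieve C \<alpha> S) = pullback_sieve C (\<alpha> \<cdot> \<beta>) S"
proof (rule set_eqI)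
  fix g
  have "\<beta> \<cdot> g \<in> hom C (Dom C (\<beta> \<cdot> g)) Y \<and> \<alpha> \<cdot> (\<beta> \<cdot> g) = (\<alpha> \<cdot> \<beta>) \<cdot> g"
    if "g \<in> hom C (Dom C g) Z"
    using comp_hom[OF assms(2) that] comp_assoc[OF assms that] by (simp add: hom_def)
  then show "g \<in> pullback_sieve C \<beta> (pullback_sieve C \<alpha> S) \<longleftrightarrow> g \<in> pullback_sieve C (\<alpha> \<cdot> \<beta>) S"
    unfolding pullback_sieve_iff[OF assms(1)] pullback_sieve_iff[OF assms(2)]
      pullback_sieve_iff[OF comp_hom[OF assms]] by metis
qed

lemma pullback_sieve_ident:
  assumes "sieve C X S"
  shows "pullback_sieve C (Ident C X) S = S"
proof -
  have X: "X \<in> Obj C" using assms by (simp add: sieve_def)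
  show ?thesis
    using sieve_hom[OF assms] comp_ident_left
    by (auto simp: pullback_sieve_iff[OF ident_hom[OF X]]) metis
qed

lemma universal_colim_sieve_effective:
  assumes "universal_colim_sieve C X S"
  shows "effective_sieve C X S"
proof -
  have sv: "sieve C X S" using assms by (simp add: universal_colim_sieve_def)
  then have "Ident C X \<in> hom C X X" by (simp add: sieve_def ident_hom)
  with assms have "effective_sieve C X (pullback_sieve C (Ident C X) S)"
    unfolding universal_colim_sieve_iff by blast
  then show ?thesis by (simp only: pullback_sieve_ident[OF sv])
qed

text \<open>Pulling back along \<open>\<alpha>\<close> and then \<open>\<beta>\<close> is pulling
  back along \<open>\<alpha> \<cdot> \<beta>\<close>, a case already covered by universality of
  \<open>S\<close>.\<close>

lemma universal_colim_sieve_pullback: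
  assumes S: "universal_colim_sieve C X S" and \<alpha>: "\<alpha> \<in> hom C Y X"
  shows "universal_colim_sieve C Y (pullback_sieve C \<alpha> S)"
  unfolding universal_colim_sieve_iff
proof (intro conjI allI ballI)
  show "sieve C Y (pullback_sieve C \<alpha> S)"
    using S \<alpha> pullback_is_sieve by (auto simp: universal_colim_sieve_def)
  fix Z \<beta> assume \<beta>: "\<beta> \<in> hom C Z Y"
  show "effective_sieve C Z (pullback_sieve C \<beta> (pullback_sieve C \<alpha> S))"
    using S comp_hom[OF \<alpha> \<beta>] unfolding pullback_sieve_comp[OF \<alpha> \<beta>] universal_colim_sieve_iff
    by blast
qed

section \<open>Maximal sieves and transitivity\<close>

lemma effective_maximal_sieve:
  assumes X: "X \<in> Obj C"
  shows "effective_sieve C X (maximal_sieve C X)"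
  unfolding effective_sieve_def matching_family_representable
proof (intro conjI ballI allI impI)
  have mem: "f \<in> maximal_sieve C X \<longleftrightarrow> f \<in> hom C (Dom C f) X" for f
    by (auto simp: maximal_sieve_def hom_def)
  note id = ident_hom[OF X]
  have id_mem: "Ident C X \<in> maximal_sieve C X" using id mem homD(2)[OF id] by simp
  show "sieve C X (maximal_sieve C X)"
    using X comp_hom by (auto simp: sieve_def maximal_sieve_def hom_def)
  fix M x
  assume "(\<forall>f\<in>maximal_sieve C X. x f \<in> hom C (Dom C f) M) \<and>
    (\<forall>f\<in>maximal_sieve C X. \<forall>g\<in>Mor C. Cod C g = Dom C f \<longrightarrow> x (f \<cdot> g) = x f \<cdot> g)"
  \<comment> \<open>As in the Yoneda lemma, the identity lies in the sieve and the value of the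
    family there determines all others; that value is the only possible gluing.\<close>
  then have x: "x (Ident C X) \<in> hom C X M"
    "\<And>g. g \<in> Mor C \<Longrightarrow> Cod C g = X \<Longrightarrow> x (Ident C X \<cdot> g) = x (Ident C X) \<cdot> g"
    using id_mem homD(2)[OF id] by auto
  show "\<exists>!t. t \<in> hom C X M \<and> (\<forall>f\<in>maximal_sieve C X. t \<cdot> f = x f)"
  proof (intro ex1I[of _ "x (Ident C X)"] conjI ballI x(1))
    fix f assume "f \<in> maximal_sieve C X"
    then have f: "f \<in> hom C (Dom C f) X" using mem by simp
    show "x (Ident C X) \<cdot> f = x f"
      using x(2)[OF homD(1)[OF f] homD(3)[OF f]] comp_ident_left[OF f] by simp
  next
    fix t assume t: "t \<in> hom C X M \<and> (\<forall>f\<in>maximal_sieve C X. t \<cdot> f = x f)"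
    then show "t = x (Ident C X)" using id_mem comp_ident_right[of t X M] by auto
  qed
qed

lemma universal_colim_maximal_sieve:
  assumes "X \<in> Obj C"
  shows "universal_colim_sieve C X (maximal_sieve C X)"
  unfolding universal_colim_sieve_iff
proof (intro conjI allI ballI)
  show "sieve C X (maximal_sieve C X)"
    using effective_maximal_sieve[OF assms] by (simp add: effective_sieve_def)
  fix Y \<alpha> assume \<alpha>: "\<alpha> \<in> hom C Y X"
  have "pullback_sieve C \<alpha> (maximal_sieve C X) = maximal_sieve C Y"
    using \<alpha> comp_hom[OF \<alpha>] by (auto simp: pullback_sieve_def maximal_sieve_def hom_def)
  then show "effective_sieve C Y (pullback_sieve C \<alpha> (maximal_sieve C X))"
    using effective_maximal_sieve dom_obj \<alpha> by (auto simp: hom_def)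
qed

text \<open>The pullbacks of \<open>R\<close> are only assumed effective, and \<open>R\<close> is
  only shown effective; universality of \<open>R\<close> follows by applying this lemma to every
  pullback of \<open>S\<close> and \<open>R\<close>.\<close>

lemma effective_sieve_transitive:
  assumes S: "universal_colim_sieve C X S" and R: "sieve C X R"
    and loc: "\<And>f. f \<in> S \<Longrightarrow> effective_sieve C (Dom C f) (pullback_sieve C f R)"
  shows "effective_sieve C X R"
  unfolding effective_sieve_def
proof (intro conjI ballI allI impI R)
  have svS: "sieve C X S" using S by (simp add: universal_colim_sieve_def)
  note effS = universal_colim_sieve_effective[OF S]
  note S_hom = sieve_hom[OF svS] and R_hom = sieve_hom[OF R]
  fix M x
  assume M: "M \<in> Obj C"
    and "matching_family C (representable_sections C M) (representable_restrict C) R x"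
  then have x: "\<And>f. f \<in> R \<Longrightarrow> x f \<in> hom C (Dom C f) M"
    and x_comp: "\<And>f g Y. f \<in> R \<Longrightarrow> g \<in> hom C Y (Dom C f) \<Longrightarrow> x (f \<cdot> g) = x f \<cdot> g"
    unfolding matching_family_representable by (auto simp: hom_def)
  \<comment> \<open>First gluing: \<open>t f\<close> is the candidate for the restriction along
    \<open>f\<close> of the map still to be found.\<close>
  have "\<exists>t. t \<in> hom C (Dom C f) M \<and> (\<forall>g. g \<in> pullback_sieve C f R \<longrightarrow> t \<cdot> g = x (f \<cdot> g))"
    if f: "f \<in> S" for f
  proof (rule effective_sieve_glue[OF loc[OF f] M, of "\<lambda>g. x (f \<cdot> g)"])
    note mem = pullback_sieve_iff[OF S_hom[OF f], of _ R]
    fix g assume "g \<in> pullback_sieve C f R"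
    then have g: "g \<in> hom C (Dom C g) (Dom C f)" and fg: "f \<cdot> g \<in> R" by (simp_all add: mem)
    have dom: "Dom C (f \<cdot> g) = Dom C g" using comp_hom[OF S_hom[OF f] g] by (simp add: hom_def)
    show "x (f \<cdot> g) \<in> hom C (Dom C g) M" using x[OF fg] dom by simp
    fix k assume k: "k \<in> hom C (Dom C k) (Dom C g)"
    show "x (f \<cdot> (g \<cdot> k)) = x (f \<cdot> g) \<cdot> k"
      using x_comp[OF fg, of k "Dom C k"] k dom comp_assoc[OF S_hom[OF f] g k] by simp
  qed blast
  then obtain t where t: "\<And>f. f \<in> S \<Longrightarrow> t f \<in> hom C (Dom C f) M"
    and t_eq: "\<And>f g. f \<in> S \<Longrightarrow> g \<in> hom C (Dom C g) (Dom C f) \<Longrightarrow> f \<cdot> g \<in> R \<Longrightarrow> t f \<cdot> g = x (f \<cdot> g)"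
    using pullback_sieve_iff[OF S_hom, of _ _ R] by metis
  \<comment> \<open>The local gluings match on \<open>S\<close>: since \<open>f \<cdot> h\<close> is
    in \<open>S\<close>, the pullback of \<open>R\<close> along it is effective, and both sides
    restrict to the values of \<open>x\<close> there.\<close>
  have t_comp: "t (f \<cdot> h) = t f \<cdot> h"
    if f: "f \<in> S" and h: "h \<in> hom C (Dom C h) (Dom C f)" for f h
  proof -
    note fh = comp_hom[OF S_hom[OF f] h] and fhS = sieve_comp[OF svS f h]
    have dom: "Dom C (f \<cdot> h) = Dom C h" using fh by (simp add: hom_def)
    show ?thesis
    proof (rule effective_sieve_ext[OF loc[OF fhS]])
      show "t (f \<cdot> h) \<in> hom C (Dom C (f \<cdot> h)) M" by (rule t[OF fhS])
      show "t f \<cdot> h \<in> hom C (Dom C (f \<cdot> h)) M" using comp_hom[OF t[OF f] h] dom by simp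
      fix g assume "g \<in> pullback_sieve C (f \<cdot> h) R"
      then have g: "g \<in> hom C (Dom C g) (Dom C h)" and R': "f \<cdot> h \<cdot> g \<in> R"
        using pullback_sieve_iff[OF fh] by simp_all
      have assoc: "f \<cdot> h \<cdot> g = f \<cdot> (h \<cdot> g)" by (rule comp_assoc[OF S_hom[OF f] h g])
      have hg: "h \<cdot> g \<in> hom C (Dom C (h \<cdot> g)) (Dom C f)"
        using comp_hom[OF h g] by (simp add: hom_def)
      have "t f \<cdot> h \<cdot> g = t f \<cdot> (h \<cdot> g)" by (rule comp_assoc[OF t[OF f] h g])
      also have "\<dots> = x (f \<cdot> h \<cdot> g)" using t_eq[OF f hg] R' assoc by simp
      also have "\<dots> = t (f \<cdot> h) \<cdot> g" using t_eq[OF fhS _ R'] g dom by simp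
      finally show "t (f \<cdot> h) \<cdot> g = t f \<cdot> h \<cdot> g" by simp
    qed
  qed
  obtain u where u: "u \<in> hom C X M" and u_eq: "\<And>f. f \<in> S \<Longrightarrow> u \<cdot> f = t f"
    using effective_sieve_glue[OF effS M, of t] t t_comp by blast
  show "\<exists>!u. u \<in> hom C X M \<and> (\<forall>f\<in>R. u \<cdot> f = x f)"
  proof (intro ex1I[of _ u] conjI ballI u)
    fix f assume f: "f \<in> R"
    note fh = R_hom[OF f]
    \<comment> \<open>A member \<open>f\<close> of \<open>R\<close> need not lie in
      \<open>S\<close>, where \<open>u\<close> is known. The test is made along those
      \<open>g\<close> for which \<open>f \<cdot> g\<close> lies in both sieves.\<close>
    have "effective_sieve C (Dom C f) (pullback_sieve C f S)"
      using S fh unfolding universal_colim_sieve_iff by blast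
    then show uf: "u \<cdot> f = x f"
    proof (rule effective_sieve_ext[OF _ comp_hom[OF u fh] x[OF f]])
      fix g assume "g \<in> pullback_sieve C f S"
      then have g: "g \<in> hom C (Dom C g) (Dom C f)" and fgS: "f \<cdot> g \<in> S"
        using pullback_sieve_iff[OF fh] by simp_all
      have fg: "f \<cdot> g \<in> hom C (Dom C g) X" by (rule comp_hom[OF fh g])
      have dom: "Dom C (f \<cdot> g) = Dom C g" using fg by (simp add: hom_def)
      \<comment> \<open>\<open>t_eq\<close> describes \<open>t (f \<cdot> g)\<close> only after
        composition with a morphism that leads into \<open>R\<close>. As \<open>f \<cdot> g\<close>
        is itself in \<open>R\<close>, the identity is such a morphism.\<close>
      let ?i = "Ident C (Dom C g)"
      have i: "?i \<in> hom C (Dom C g) (Dom C g)"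
        using g dom_obj ident_hom by (auto simp: hom_def)
      have fgi: "f \<cdot> g \<cdot> ?i = f \<cdot> g" by (rule comp_ident_right[OF fg])
      have "t (f \<cdot> g) = t (f \<cdot> g) \<cdot> ?i" using comp_ident_right[OF t[OF fgS]] dom by simp
      also have "\<dots> = x (f \<cdot> g)"
        using t_eq[OF fgS, of ?i] i dom fgi sieve_comp[OF R f g] homD(2)[OF i] by simp
      also have "\<dots> = x f \<cdot> g" by (rule x_comp[OF f g])
      finally show "u \<cdot> f \<cdot> g = x f \<cdot> g"
        using comp_assoc[OF u fh g] u_eq[OF fgS] by simp
    qed
  next
    fix v assume v: "v \<in> hom C X M \<and> (\<forall>f\<in>R. v \<cdot> f = x f)"
    then have vh: "v \<in> hom C X M" by blast
    \<comment> \<open>Uniqueness separates twice: first along members of \<open>S\<close>, then, for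
      each such \<open>f\<close>, along the pullback of \<open>R\<close>, where both maps give
      \<open>x (f \<cdot> g)\<close>.\<close>
    show "v = u"
    proof (rule effective_sieve_ext[OF effS vh u])
      fix f assume f: "f \<in> S"
      note fh = S_hom[OF f]
      show "v \<cdot> f = u \<cdot> f"
      proof (rule effective_sieve_ext[OF loc[OF f] comp_hom[OF vh fh] comp_hom[OF u fh]])
        fix g assume "g \<in> pullback_sieve C f R"
        then have g: "g \<in> hom C (Dom C g) (Dom C f)" and R': "f \<cdot> g \<in> R"
          using pullback_sieve_iff[OF fh] by simp_all
        have "v \<cdot> f \<cdot> g = x (f \<cdot> g)" using comp_assoc[OF vh fh g] v R' by simp
        then show "v \<cdot> f \<cdot> g = u \<cdot> f \<cdot> g" using t_eq[OF f g R'] u_eq[OF f] by simp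
      qed
    qed
  qed
qed

text \<open>For \<open>g\<close> in the pullback of \<open>S\<close> along \<open>\<alpha>\<close>,
  pulling \<open>R\<close> back along \<open>\<alpha>\<close> and then \<open>g\<close> is pulling
  it back along \<open>\<alpha> \<cdot> g\<close>, a member of \<open>S\<close>, where
  \<open>loc\<close> applies.\<close>

lemma universal_colim_sieve_transitive:
  assumes S: "universal_colim_sieve C X S" and R: "sieve C X R"
    and loc: "\<And>f. f \<in> S \<Longrightarrow> universal_colim_sieve C (Dom C f) (pullback_sieve C f R)"
  shows "universal_colim_sieve C X R"
  unfolding universal_colim_sieve_iff
proof (intro conjI allI ballI R)
  fix Y \<alpha> assume \<alpha>: "\<alpha> \<in> hom C Y X"
  show "effective_sieve C Y (pullback_sieve C \<alpha> R)"
  proof (rule effective_sieve_transitive[OF universal_colim_sieve_pullback[OF S \<alpha>]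
        pullback_is_sieve[OF R \<alpha>]])
    fix g assume "g \<in> pullback_sieve C \<alpha> S"
    then have g: "g \<in> hom C (Dom C g) Y" and \<alpha>g: "\<alpha> \<cdot> g \<in> S"
      using pullback_sieve_iff[OF \<alpha>] by simp_all
    have "Dom C (\<alpha> \<cdot> g) = Dom C g" using comp_hom[OF \<alpha> g] by (simp add: hom_def)
    then show "effective_sieve C (Dom C g) (pullback_sieve C g (pullback_sieve C \<alpha> R))"
      using universal_colim_sieve_effective[OF loc[OF \<alpha>g]] pullback_sieve_comp[OF \<alpha> g] by simp
  qed
qed

section \<open>The topology of universal colim sieves and its maximality\<close>

lemma grothendieck_topology_universal_colim_sieves:
  "grothendieck_topology C (universal_colim_sieves C)"
proof -
  have "universal_colim_sieve C (Dom C \<alpha>) (pullback_sieve C \<alpha> S)"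
    if "universal_colim_sieve C (Cod C \<alpha>) S" "\<alpha> \<in> Mor C" for S \<alpha>
    using universal_colim_sieve_pullback[OF that(1)] that(2) by (simp add: hom_def)
  moreover have "sieve C X S" if "universal_colim_sieve C X S" for X S
    using that by (simp add: universal_colim_sieve_def)
  ultimately show ?thesis
    unfolding grothendieck_topology_def universal_colim_sieves_def
    by (auto intro: universal_colim_maximal_sieve universal_colim_sieve_transitive)
qed

text \<open>Representables are presheaves, so the two sides differ only in the order of quantifying
  over \<open>M\<close> and over \<open>K\<close>. Stated for any collection of sieves, it applies
  both to the universal colim sieves and to a competing topology.\<close>

lemma representables_are_sheaves_iff:
  assumes "\<And>X S. (X, S) \<in> K \<Longrightarrow> sieve C X S"
  shows "representables_are_sheaves C K \<longleftrightarrow> (\<forall>(X, S) \<in> K. effective_sieve C X S)"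
proof -
  have "sheaf C K (representable_sections C M) (representable_restrict C) \<longleftrightarrow>
      (\<forall>(X, S) \<in> K. \<forall>x.
        matching_family C (representable_sections C M) (representable_restrict C) S x \<longrightarrow>
        (\<exists>!t. t \<in> hom C X M \<and> (\<forall>f \<in> S. t \<cdot> f = x f)))" for M
    by (simp add: sheaf_def representable_presheaf)
      (simp add: representable_sections_def representable_restrict_def)
  moreover have "(\<forall>M \<in> Obj C. \<forall>(X, S) \<in> K. G M X S) \<longleftrightarrow>
      (\<forall>(X, S) \<in> K. sieve C X S \<and> (\<forall>M \<in> Obj C. G M X S))" for G
    using assms by auto
  ultimately show ?thesis by (simp only: representables_are_sheaves_def effective_sieve_def)
qed

end

theorem theorem6p1:
  fixes C :: "('o, 'm) cat"
  assumes "category C"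
  shows "canonical_topology C (universal_colim_sieves C)"
proof -
  interpret category C by fact
  show ?thesis unfolding canonical_topology_def
  proof (intro conjI allI impI grothendieck_topology_universal_colim_sieves)
    show "representables_are_sheaves C (universal_colim_sieves C)"
      by (subst representables_are_sheaves_iff)
        (auto simp: universal_colim_sieves_def universal_colim_sieve_def[of C]
          intro: universal_colim_sieve_effective)
  next
    fix K assume K: "grothendieck_topology C K" "representables_are_sheaves C K"
    have sv: "\<And>X S. (X, S) \<in> K \<Longrightarrow> sieve C X S"
      and pb: "\<And>X S \<alpha> Y. (X, S) \<in> K \<Longrightarrow> \<alpha> \<in> hom C Y X \<Longrightarrow> (Y, pullback_sieve C \<alpha> S) \<in> K"
      using K(1) unfolding grothendieck_topology_def hom_def by blast+
    have eff: "\<And>X S. (X, S) \<in> K \<Longrightarrow> effective_sieve C X S"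
      using K(2) representables_are_sheaves_iff[OF sv] by blast
    \<comment> \<open>Each pullback of a member of \<open>K\<close> is again in \<open>K\<close>,
      hence effective, which is exactly universality.\<close>
    show "K \<subseteq> universal_colim_sieves C"
      using sv eff[OF pb] by (auto simp: universal_colim_sieves_def universal_colim_sieve_iff)
  qed
qed

end
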